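(* Let $p\ge 1$, let $n\ge 1$, and let $\xi=(\xi_1,\dots,\xi_n)$ be a random vector in $\mathbb{R}^n$ defined on a probability space $(\Omega,\Sigma,\mathbb{P})$ with $\max_{1\le i\le n}\|\xi_i\|_{\psi_p}<\infty$. Then $$\max_{1\le i\le n}\|\xi_i\|_{\psi_p}\le\|\xi\|_{\psi_p}\le \|\xi\|_{E_p}\le n^{1/p}\max_{1\le i\le n}\|\xi_i\|_{\psi_p}.$$
   Context: For a real random variable $\eta$ and $p\ge 1$, the $\psi_p$-norm is $\|\eta\|_{\psi_p}=\inf\{K>0:\ \mathbb{E}\exp(|\eta/K|^p)\le 2\}$ (with value $\infty$ if no such $K$ exists). For $x\in\mathbb{R}^n$ and $1\le p<\infty$, $|x|_p=(\sum_{i=1}^n|x_i|^p)^{1/p}$, and $|x|_\infty=\max_{1\le i\le n}|x_i|$; $\langle\cdot,\cdot\rangle$ is the standard inner product on $\mathbb{R}^n$. The exponent $q\in(1,\infty]$ is the Hölder conjugate of $p$, i.e. $q=p/(p-1)$ (and $q=\infty$ if $p=1$). For a random vector $\xi=(\xi_i)_{i=1}^n$ define $$\|\xi\|_{\psi_p}=\sup_{|\mathbf{t}|_q=1}\|\langle\xi,\mathbf{t}\rangle\|_{\psi_p},$$ the supremum being over deterministic $\mathbf{t}\in\mathbb{R}^n$, and $$\|\xi\|_{E_p}=\big\||\xi|_p\big\|_{\psi_p}=\inf\Big\{K>0:\ \mathbb{E}\exp\Big(\frac{\sum_{i=1}^n|\xi_i|^p}{K^p}\Big)\le 2\Big\}.$$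 *)

theory Defs
  imports "HOL-Probability.Probability"
begin

text \<open>The expectation is a nonnegative Lebesgue integral, so that an infinite expectation is
  never \<open>\<le> 2\<close>. Values lie in \<open>ennreal\<close>, where the infimum of the empty set is \<open>\<infinity>\<close>.\<close>

definition psi_norm :: "'a measure \<Rightarrow> real \<Rightarrow> ('a \<Rightarrow> real) \<Rightarrow> ennreal" where
  "psi_norm M p \<eta> =
     (INF K\<in>{K::real. K > 0 \<and> (\<integral>\<^sup>+ \<omega>. ennreal (exp (\<bar>\<eta> \<omega> / K\<bar> powr p)) \<partial>M) \<le> 2}. ennreal K)"

definition hoelder_conj :: "real \<Rightarrow> ereal" where
  "hoelder_conj p = (if p = 1 then \<infinity> else ereal (p / (p - 1)))"

definition lp_norm :: "ereal \<Rightarrow> real ^ 'n \<Rightarrow> real" where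
  "lp_norm r x =
     (if r = \<infinity> then MAX i. \<bar>x $ i\<bar>
      else (\<Sum>i\<in>UNIV. \<bar>x $ i\<bar> powr real_of_ereal r) powr (1 / real_of_ereal r))"

definition psi_norm_vec :: "'a measure \<Rightarrow> real \<Rightarrow> ('a \<Rightarrow> real ^ 'n) \<Rightarrow> ennreal" where
  "psi_norm_vec M p \<xi> =
     (SUP t\<in>{t. lp_norm (hoelder_conj p) t = 1}. psi_norm M p (\<lambda>\<omega>. \<xi> \<omega> \<bullet> t))"

definition E_norm :: "'a measure \<Rightarrow> real \<Rightarrow> ('a \<Rightarrow> real ^ 'n) \<Rightarrow> ennreal" where
  "E_norm M p \<xi> = psi_norm M p (\<lambda>\<omega>. lp_norm (ereal p) (\<xi> \<omega>))"

lemma E_norm_eq_INF: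
  assumes "p \<ge> 1"
  shows "E_norm M p \<xi> =
    (INF K\<in>{K::real. K > 0 \<and>
       (\<integral>\<^sup>+ \<omega>. ennreal (exp ((\<Sum>i\<in>UNIV. \<bar>\<xi> \<omega> $ i\<bar> powr p) / K powr p)) \<partial>M) \<le> 2}. ennreal K)"
proof -
  have "\<bar>lp_norm (ereal p) x / K\<bar> powr p = (\<Sum>i\<in>UNIV. \<bar>x $ i\<bar> powr p) / K powr p"
    if "K > 0" for K :: real and x :: "real ^ 'b"
  proof -
    have "0 \<le> (\<Sum>i\<in>UNIV. \<bar>x $ i\<bar> powr p)"
      by (intro sum_nonneg) simp
    with that assms show ?thesis
      by (simp add: lp_norm_def powr_divide powr_powr abs_mult)
  qed
  then show ?thesis
    unfolding E_norm_def psi_norm_def by (intro INF_cong) (auto cong: conj_cong)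
qed

end

theory Submission
  imports Defs
begin

text \<open>The first inequality tests against the standard basis and the second is Hoelder's
  inequality. For the third, AM-GM bounds \<open>exp ((\<Sum>i. \<bar>\<xi>\<^sub>i / K\<bar> powr p) / n)\<close> by the average of the
  \<open>exp (\<bar>\<xi>\<^sub>i / K\<bar> powr p)\<close>, each of which has expectation at most 2 as soon as \<open>K\<close> exceeds the
  maximal \<open>\<psi>\<^sub>p\<close>-norm.\<close>

text \<open>Each factor is divided by its own norm, \<open>s\<close> or \<open>t\<close>. Young's
  inequality applied termwise then bounds the normalised sum by \<open>1 / p + 1 / q = 1\<close>,
  and multiplying back by \<open>s * t\<close> gives the claim.\<close>

lemma Holder_inequality_sum:
  fixes a b :: "'i \<Rightarrow> real"
  assumes "finite I" "p > 1" "q > 1" "1 / p + 1 / q = 1"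
    and a: "\<And>i. i \<in> I \<Longrightarrow> a i \<ge> 0" and b: "\<And>i. i \<in> I \<Longrightarrow> b i \<ge> 0"
  shows "(\<Sum>i\<in>I. a i * b i)
    \<le> (\<Sum>i\<in>I. a i powr p) powr (1 / p) * (\<Sum>i\<in>I. b i powr q) powr (1 / q)"
proof -
  define A B where "A = (\<Sum>i\<in>I. a i powr p)" and "B = (\<Sum>i\<in>I. b i powr q)"
  define s t where "s = A powr (1 / p)" and "t = B powr (1 / q)"
  have A0: "A \<ge> 0" and B0: "B \<ge> 0"
    by (auto simp: A_def B_def intro!: sum_nonneg)
  show ?thesis
  proof (cases "A = 0 \<or> B = 0")
    case True
    \<comment> \<open>Normalising is impossible here, but a vanishing sum of powers forces that
      whole factor to be zero on \<open>I\<close>.\<close>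
    then have "\<forall>i\<in>I. a i * b i = 0"
      using assms(1) by (auto simp: A_def B_def sum_nonneg_eq_0_iff)
    then show ?thesis by (simp add: sum.neutral)
  next
    case False
    then have AB: "A > 0" "B > 0" using A0 B0 by auto
    then have st: "s > 0" "t > 0" by (auto simp: s_def t_def)
    have sp: "s powr p = A" "t powr q = B"
      using AB assms(2,3) by (auto simp: s_def t_def powr_powr)
    have "(\<Sum>i\<in>I. (a i / s) * (b i / t))
      \<le> (\<Sum>i\<in>I. (a i / s) powr p / p + (b i / t) powr q / q)"
      using assms st by (intro sum_mono Youngs_inequality) auto
    also have "\<dots> = (\<Sum>i\<in>I. a i powr p) / A / p + (\<Sum>i\<in>I. b i powr q) / B / q"
      unfolding sum.distrib sum_divide_distrib
      using a b st by (simp add: powr_divide sp)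
    also have "\<dots> = 1"
      using AB assms(4) by (simp flip: A_def B_def)
    finally have "(\<Sum>i\<in>I. a i * b i) / (s * t) \<le> 1"
      by (simp add: sum_divide_distrib)
    then show ?thesis
      using st by (simp add: divide_le_eq flip: A_def B_def s_def t_def)
  qed
qed

lemma abs_inner_le_sum_abs:
  fixes x y :: "real ^ 'n"
  shows "\<bar>x \<bullet> y\<bar> \<le> (\<Sum>i\<in>UNIV. \<bar>x $ i\<bar> * \<bar>y $ i\<bar>)"
  unfolding inner_vec_def by (rule order_trans[OF sum_abs]) (simp add: abs_mult)

text \<open>The endpoint \<open>p = 1\<close> is treated separately: its conjugate exponent is
  infinite, so each \<open>\<bar>y $ i\<bar>\<close> is bounded by the maximum. For
  \<open>p > 1\<close> the exponent \<open>p / (p - 1)\<close> is finite and the power-sum form of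
  Hoelder applies.\<close>

lemma abs_inner_le_lp_norm:
  fixes x y :: "real ^ 'n"
  assumes "p \<ge> 1"
  shows "\<bar>x \<bullet> y\<bar> \<le> lp_norm (ereal p) x * lp_norm (hoelder_conj p) y"
proof (cases "p = 1")
  case True
  have "(\<Sum>i\<in>UNIV. \<bar>x $ i\<bar> * \<bar>y $ i\<bar>) \<le> (\<Sum>i\<in>UNIV. \<bar>x $ i\<bar> * (MAX i. \<bar>y $ i\<bar>))"
    by (intro sum_mono mult_left_mono) auto
  also have "\<dots> = lp_norm (ereal p) x * lp_norm (hoelder_conj p) y"
    using True by (simp add: lp_norm_def hoelder_conj_def sum_distrib_right sum_nonneg)
  finally show ?thesis using abs_inner_le_sum_abs order_trans by blast
next
  case False
  then have "(\<Sum>i\<in>UNIV. \<bar>x $ i\<bar> * \<bar>y $ i\<bar>)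
    \<le> (\<Sum>i\<in>UNIV. \<bar>x $ i\<bar> powr p) powr (1 / p)
      * (\<Sum>i\<in>UNIV. \<bar>y $ i\<bar> powr (p / (p - 1))) powr (1 / (p / (p - 1)))"
    using assms by (intro Holder_inequality_sum) (auto simp: field_simps)
  also have "\<dots> = lp_norm (ereal p) x * lp_norm (hoelder_conj p) y"
    using False by (simp add: lp_norm_def hoelder_conj_def)
  finally show ?thesis using abs_inner_le_sum_abs order_trans by blast
qed

text \<open>This makes the standard basis vectors admissible in the supremum that defines
  \<open>psi_norm_vec\<close>, whether the conjugate exponent is finite or infinite.\<close>

lemma lp_norm_axis:
  assumes "r > 0"
  shows "lp_norm r (axis k 1 :: real ^ 'n) = 1"
proof (cases "r = \<infinity>")
  case True
  have "(MAX i. \<bar>(axis k 1 :: real ^ 'n) $ i\<bar>) = 1"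
    by (intro Max_eqI) (auto simp: axis_def image_iff)
  with True show ?thesis by (simp add: lp_norm_def)
next
  case False
  \<comment> \<open>This holds for every real \<open>s\<close>, even \<open>s = 0\<close>, because
    \<open>0 powr s = 0\<close> by convention.\<close>
  have "\<bar>(axis k 1 :: real ^ 'n) $ i\<bar> powr s = (if i = k then 1 else 0)" for i s
    by (simp add: axis_def)
  with False show ?thesis by (simp add: lp_norm_def)
qed

lemma nn_integral_exp_mono:
  assumes "p \<ge> 0" and "\<And>\<omega>. \<bar>f \<omega>\<bar> \<le> \<bar>g \<omega>\<bar>"
  shows "(\<integral>\<^sup>+ \<omega>. ennreal (exp (\<bar>f \<omega>\<bar> powr p)) \<partial>M) \<le> (\<integral>\<^sup>+ \<omega>. ennreal (exp (\<bar>g \<omega>\<bar> powr p)) \<partial>M)"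
  using assms by (intro nn_integral_mono ennreal_leI) (simp add: powr_mono2)

text \<open>Every \<open>K\<close> admissible for the larger function is admissible for the smaller
  one, so the infimum for the latter runs over a larger set.\<close>

lemma psi_norm_mono:
  assumes "p \<ge> 0" and "\<And>\<omega>. \<bar>f \<omega>\<bar> \<le> \<bar>g \<omega>\<bar>"
  shows "psi_norm M p f \<le> psi_norm M p g"
  unfolding psi_norm_def
proof (rule INF_superset_mono; clarify)
  fix K :: real
  assume "K > 0" and g: "(\<integral>\<^sup>+ \<omega>. ennreal (exp (\<bar>g \<omega> / K\<bar> powr p)) \<partial>M) \<le> 2"
  then show "(\<integral>\<^sup>+ \<omega>. ennreal (exp (\<bar>f \<omega> / K\<bar> powr p)) \<partial>M) \<le> 2"
    using assms by (intro order_trans[OF nn_integral_exp_mono g]) (auto intro: divide_right_mono)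
qed

text \<open>The admissible constants are upward closed: some admissible \<open>K'\<close> lies below
  \<open>K\<close>, and replacing \<open>K'\<close> by \<open>K\<close> only shrinks the
  integrand.\<close>

lemma nn_integral_exp_le_2_if_psi_norm_less:
  assumes "p \<ge> 0" and "psi_norm M p f < ennreal K"
  shows "(\<integral>\<^sup>+ \<omega>. ennreal (exp (\<bar>f \<omega> / K\<bar> powr p)) \<partial>M) \<le> 2"
proof -
  obtain K' where K': "K' > 0" "ennreal K' < ennreal K"
    and f: "(\<integral>\<^sup>+ \<omega>. ennreal (exp (\<bar>f \<omega> / K'\<bar> powr p)) \<partial>M) \<le> 2"
    using assms(2) unfolding psi_norm_def INF_less_iff by auto
  from K' have "K' < K" by (simp add: ennreal_less_iff)
  with K'(1) assms(1) show ?thesis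
    by (intro order_trans[OF nn_integral_exp_mono f]) (auto intro: divide_left_mono)
qed

text \<open>The left side is the geometric mean of the numbers \<open>exp (y i)\<close>, the right
  side their arithmetic mean.\<close>

lemma exp_average_le:
  fixes y :: "'n::finite \<Rightarrow> real"
  shows "exp ((\<Sum>i\<in>UNIV. y i) / CARD('n)) \<le> (\<Sum>i\<in>UNIV. exp (y i) / CARD('n))"
  using arith_geom_mean[of "UNIV :: 'n set" "\<lambda>i. exp (y i)"]
  by (simp add: powr_def exp_sum[symmetric])

lemma E_norm_le:
  fixes \<xi> :: "'a \<Rightarrow> real ^ 'n"
  assumes "p \<ge> 1" and [measurable]: "\<xi> \<in> borel_measurable M" and "K > 0"
    and K: "\<And>i. (\<integral>\<^sup>+ \<omega>. ennreal (exp (\<bar>\<xi> \<omega> $ i / K\<bar> powr p)) \<partial>M) \<le> 2"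
  shows "E_norm M p \<xi> \<le> ennreal (real CARD('n) powr (1 / p) * K)"
proof -
  define n where "n = real CARD('n)"
  \<comment> \<open>The factor \<open>n powr (1 / p)\<close> is chosen so that dividing by
    \<open>L powr p\<close> turns the sum of powers into an average of the
    \<open>\<bar>\<xi> \<omega> $ i / K\<bar> powr p\<close>.\<close>
  define L where "L = n powr (1 / p) * K"
  have n: "n > 0" by (simp add: n_def)
  have Lp: "L powr p = n * K powr p"
    using assms n by (simp add: L_def powr_mult powr_powr)
  have [measurable]: "(\<lambda>\<omega>. \<xi> \<omega> $ i) \<in> borel_measurable M" for i
    using assms(2) by (rule measurable_compose) (rule borel_measurable_nth)
  have "(\<integral>\<^sup>+ \<omega>. ennreal (exp ((\<Sum>i\<in>UNIV. \<bar>\<xi> \<omega> $ i\<bar> powr p) / L powr p)) \<partial>M)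
    \<le> (\<integral>\<^sup>+ \<omega>. (\<Sum>i\<in>UNIV. ennreal (1 / n) * ennreal (exp (\<bar>\<xi> \<omega> $ i / K\<bar> powr p))) \<partial>M)"
  proof (rule nn_integral_mono)
    fix \<omega>
    have "(\<Sum>i\<in>UNIV. \<bar>\<xi> \<omega> $ i\<bar> powr p) / L powr p = (\<Sum>i\<in>UNIV. \<bar>\<xi> \<omega> $ i / K\<bar> powr p) / n"
      using \<open>K > 0\<close> by (simp add: Lp powr_divide sum_divide_distrib mult.commute)
    also have "exp \<dots> \<le> (\<Sum>i\<in>UNIV. exp (\<bar>\<xi> \<omega> $ i / K\<bar> powr p) / n)"
      unfolding n_def by (rule exp_average_le)
    finally show "ennreal (exp ((\<Sum>i\<in>UNIV. \<bar>\<xi> \<omega> $ i\<bar> powr p) / L powr p))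
        \<le> (\<Sum>i\<in>UNIV. ennreal (1 / n) * ennreal (exp (\<bar>\<xi> \<omega> $ i / K\<bar> powr p)))"
      using n by (simp add: ennreal_leI flip: ennreal_mult)
  qed
  also have "\<dots> = (\<Sum>i\<in>UNIV. ennreal (1 / n) * (\<integral>\<^sup>+ \<omega>. ennreal (exp (\<bar>\<xi> \<omega> $ i / K\<bar> powr p)) \<partial>M))"
    by (simp add: nn_integral_sum nn_integral_cmult)
  \<comment> \<open>An average of quantities that are at most 2 is again at most 2, so
    \<open>L\<close> meets the same threshold as \<open>K\<close>.\<close>
  also have "\<dots> \<le> (\<Sum>i\<in>(UNIV :: 'n set). ennreal (1 / n) * 2)"
    by (intro sum_mono mult_left_mono K) simp
  also have "\<dots> = ennreal n * ennreal (1 / n) * 2"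
    by (simp add: n_def ennreal_of_nat_eq_real_of_nat mult.assoc)
  also have "\<dots> = 2" using n by (simp flip: ennreal_mult)
  finally have "(\<integral>\<^sup>+ \<omega>. ennreal (exp ((\<Sum>i\<in>UNIV. \<bar>\<xi> \<omega> $ i\<bar> powr p) / L powr p)) \<partial>M) \<le> 2" .
  moreover have "L > 0" using n \<open>K > 0\<close> by (simp add: L_def)
  ultimately have "E_norm M p \<xi> \<le> ennreal L"
    unfolding E_norm_eq_INF[OF \<open>p \<ge> 1\<close>] by (intro INF_lower) simp
  then show ?thesis by (simp add: L_def n_def)
qed

theorem proposition2p1:
  fixes M :: "'a measure" and p :: real and \<xi> :: "'a \<Rightarrow> real ^ 'n"
  assumes "prob_space M"
    and "p \<ge> 1"
    and "\<xi> \<in> borel_measurable M"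
    and "(MAX i. psi_norm M p (\<lambda>\<omega>. \<xi> \<omega> $ i)) < \<infinity>"
  shows "(MAX i. psi_norm M p (\<lambda>\<omega>. \<xi> \<omega> $ i)) \<le> psi_norm_vec M p \<xi>
    \<and> psi_norm_vec M p \<xi> \<le> E_norm M p \<xi>
    \<and> E_norm M p \<xi> \<le> ennreal (real CARD('n) powr (1 / p)) * (MAX i. psi_norm M p (\<lambda>\<omega>. \<xi> \<omega> $ i))"
proof (intro conjI)
  have "psi_norm M p (\<lambda>\<omega>. \<xi> \<omega> $ i) \<le> psi_norm_vec M p \<xi>" for i
  proof -
    have "lp_norm (hoelder_conj p) (axis i 1 :: real ^ 'n) = 1"
      using assms(2) by (intro lp_norm_axis) (auto simp: hoelder_conj_def)
    then have "psi_norm M p (\<lambda>\<omega>. \<xi> \<omega> \<bullet> axis i 1) \<le> psi_norm_vec M p \<xi>"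
      unfolding psi_norm_vec_def by (intro SUP_upper) simp
    then show ?thesis by (simp add: inner_axis)
  qed
  then show "(MAX i. psi_norm M p (\<lambda>\<omega>. \<xi> \<omega> $ i)) \<le> psi_norm_vec M p \<xi>"
    by simp
  show "psi_norm_vec M p \<xi> \<le> E_norm M p \<xi>"
    unfolding psi_norm_vec_def E_norm_def
  proof (intro SUP_least psi_norm_mono)
    fix t :: "real ^ 'n" and \<omega>
    \<comment> \<open>The normalisation of \<open>t\<close> removes the second factor in Hoelder's
      inequality.\<close>
    assume "t \<in> {t. lp_norm (hoelder_conj p) t = 1}"
    then show "\<bar>\<xi> \<omega> \<bullet> t\<bar> \<le> \<bar>lp_norm (ereal p) (\<xi> \<omega>)\<bar>"
      using abs_inner_le_lp_norm[OF assms(2), of "\<xi> \<omega>" t] by simp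
  qed (use assms(2) in simp)
  define c where "c = real CARD('n) powr (1 / p)"
  have c: "c > 0" by (simp add: c_def)
  obtain m where m: "m \<ge> 0" "(MAX i. psi_norm M p (\<lambda>\<omega>. \<xi> \<omega> $ i)) = ennreal m"
    using assms(4) by (cases "MAX i. psi_norm M p (\<lambda>\<omega>. \<xi> \<omega> $ i)" rule: ennreal_cases) auto
  \<comment> \<open>Constants strictly above \<open>m\<close> are admissible for every coordinate,
    whereas \<open>m\<close> itself may be 0 and then is not an allowed constant. Hence the slack
    \<open>e\<close>, removed at the end.\<close>
  have "E_norm M p \<xi> \<le> ennreal (c * m) + ennreal e" if "e > 0" for e
  proof -
    \<comment> \<open>The excess over \<open>m\<close> is \<open>e / c\<close>, so that scaling by
      \<open>c\<close> leaves exactly \<open>e\<close>.\<close>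
    define K where "K = m + e / c"
    have "m < K" "K > 0" using m that c by (auto simp: K_def add_nonneg_pos)
    have "psi_norm M p (\<lambda>\<omega>. \<xi> \<omega> $ i) < ennreal K" for i
    proof -
      have "psi_norm M p (\<lambda>\<omega>. \<xi> \<omega> $ i) \<le> ennreal m"
        unfolding m(2)[symmetric] by (intro Max_ge) auto
      also have "\<dots> < ennreal K" using \<open>m < K\<close> m by (simp add: ennreal_less_iff)
      finally show ?thesis .
    qed
    then have "E_norm M p \<xi> \<le> ennreal (c * K)"
      unfolding c_def using assms(2,3) \<open>K > 0\<close>
      by (intro E_norm_le nn_integral_exp_le_2_if_psi_norm_less) auto
    also have "c * K = c * m + e" using c by (simp add: K_def field_simps)
    finally show ?thesis using m c that by (simp add: ennreal_plus)
  qed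
  then have "E_norm M p \<xi> \<le> ennreal (c * m)" by (rule ennreal_le_epsilon)
  then show "E_norm M p \<xi> \<le> ennreal (real CARD('n) powr (1 / p)) * (MAX i. psi_norm M p (\<lambda>\<omega>. \<xi> \<omega> $ i))"
    unfolding m(2) using m(1) by (simp add: c_def ennreal_mult)
qed

end
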